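(* Let $X$ be a metric space, $V$ a Banach space, and let $C=(\varphi,\Phi)$ be a skew-evolution semiflow on $Y=X\times V$. Assume that $C$ is strongly measurable and has bounded exponential growth. Then $C$ is exponentially stable if and only if $C$ is exponentially integrally stable.
   Context: Notation: $(X,d)$ is a metric space, $V$ is a Banach space, $\mathcal{B}(V)$ is the space of bounded linear operators on $V$, $I$ is the identity operator, $\|\cdot\|$ denotes the norms on $V$ and $\mathcal{B}(V)$, $Y=X\times V$, $\mathbb{R}_+=[0,\infty)$, $\mathbb{R}_+^*=(0,\infty)$, and $T=\{(t,t_0)\in\mathbb{R}_+^2 : t\ge t_0\}$. An evolution semiflow on $X$ is a mapping $\varphi:T\times X\to X$ such that $\varphi(t,t,x)=x$ for all $(t,x)\in\mathbb{R}_+\times X$, and $\varphi(t,s,\varphi(s,t_0,x))=\varphi(t,t_0,x)$ for all $(t,s),(s,t_0)\in T$ and $x\in X$. An evolution cocycle over $\varphi$ is a mapping $\Phi:T\times X\to\mathcal{B}(V)$ such that $\Phi(t,t,x)=I$ for all $t\ge 0$, $x\in X$, and $\Phi(t,s,\varphi(s,t_0,x))\Phi(s,t_0,x)=\Phi(t,t_0,x)$ for all $(t,s),(s,t_0)\in T$ and $x\in X$. If $\Phi$ is an evolution cocycle over the evolution semiflow $\varphi$, the mapping $C:T\times Y\to Y$, $C(t,s,x,v)=(\varphi(t,s,x),\Phi(t,s,x)v)$, is called a skew-evolution semiflow on $Y$, written $C=(\varphi,\Phi)$. $C$ is strongly measurable if for all $(t_0,x,v)\in\mathbb{R}_+\times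 X\times V$ the mapping $s\mapsto\|\Phi(s,t_0,x)v\|$ is measurable on $[t_0,\infty)$. $C$ has exponential growth if there exist nondecreasing mappings $M,\omega:\mathbb{R}_+\to[1,\infty)$ such that $\|\Phi(t,t_0,x)v\|\le M(s)e^{\omega(t-s)}\|\Phi(s,t_0,x)v\|$ for all $(t,s),(s,t_0)\in T$ and all $(x,v)\in Y$ (here $\omega(t-s)$ is the value of the function $\omega$ at $t-s$). $C$ has bounded exponential growth if it has exponential growth with a bounded function $M$. $C$ is exponentially stable if there exist a mapping $N:\mathbb{R}_+\to[1,\infty)$ and a constant $\alpha>0$ such that $\|\Phi(t,t_0,x)v\|\le N(s)e^{-\alpha t}\|\Phi(s,t_0,x)v\|$ for all $(t,s),(s,t_0)\in T$ and all $(x,v)\in Y$. $C$ is exponentially integrally stable if there exist a mapping $D:\mathbb{R}_+\to\mathbb{R}_+^*$ and a constant $d>0$ such that $\int_s^\infty e^{(t-s)d}\|\Phi(t,t_0,x)v\|\,dt\le D(s)\|\Phi(s,t_0,x)v\|$ for all $(s,t_0)\in T$ and all $(x,v)\in Y$. *)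

theory Defs
  imports "HOL-Analysis.Analysis"
begin

definition evol_times :: "(real \<times> real) set" where
  "evol_times = {(t, t0). 0 \<le> t0 \<and> t0 \<le> t}"

(* Maps on T x X are total curried functions; their values outside evol_times are
   arbitrary and never constrained. *)

definition evolution_semiflow :: "(real \<Rightarrow> real \<Rightarrow> 'x \<Rightarrow> 'x) \<Rightarrow> bool" where
  "evolution_semiflow \<phi> \<longleftrightarrow>
     (\<forall>t\<ge>0. \<forall>x. \<phi> t t x = x) \<and>
     (\<forall>t s t0 x. (t, s) \<in> evol_times \<longrightarrow> (s, t0) \<in> evol_times \<longrightarrow>
        \<phi> t s (\<phi> s t0 x) = \<phi> t t0 x)"

definition evolution_cocycle ::
  "(real \<Rightarrow> real \<Rightarrow> 'x \<Rightarrow> 'x) \<Rightarrow> (real \<Rightarrow> real \<Rightarrow> 'x \<Rightarrow> 'v::real_normed_vector \<Rightarrow>\<^sub>L 'v) \<Rightarrow> bool"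
where
  "evolution_cocycle \<phi> \<Phi> \<longleftrightarrow>
     (\<forall>t\<ge>0. \<forall>x. \<Phi> t t x = id_blinfun) \<and>
     (\<forall>t s t0 x. (t, s) \<in> evol_times \<longrightarrow> (s, t0) \<in> evol_times \<longrightarrow>
        \<Phi> t s (\<phi> s t0 x) o\<^sub>L \<Phi> s t0 x = \<Phi> t t0 x)"

definition skew_evolution_semiflow ::
  "(real \<Rightarrow> real \<Rightarrow> 'x \<Rightarrow> 'x) \<Rightarrow> (real \<Rightarrow> real \<Rightarrow> 'x \<Rightarrow> 'v::real_normed_vector \<Rightarrow>\<^sub>L 'v) \<Rightarrow>
   (real \<Rightarrow> real \<Rightarrow> 'x \<times> 'v \<Rightarrow> 'x \<times> 'v) \<Rightarrow> bool"
where
  "skew_evolution_semiflow \<phi> \<Phi> C \<longleftrightarrow>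
     evolution_semiflow \<phi> \<and> evolution_cocycle \<phi> \<Phi> \<and>
     (\<forall>(t, s)\<in>evol_times. \<forall>x v. C t s (x, v) = (\<phi> t s x, blinfun_apply (\<Phi> t s x) v))"

(* In the properties below, snd (C t s (x, v)) is the vector \<Phi>(t,s,x)v of C = (\<phi>,\<Phi>). *)

definition strongly_measurable ::
  "(real \<Rightarrow> real \<Rightarrow> 'x \<times> 'v::real_normed_vector \<Rightarrow> 'x \<times> 'v) \<Rightarrow> bool" where
  "strongly_measurable C \<longleftrightarrow>
     (\<forall>t0\<ge>0. \<forall>x v. (\<lambda>s. norm (snd (C s t0 (x, v)))) \<in> borel_measurable (lebesgue_on {t0..}))"

definition exponential_growth_with ::
  "(real \<Rightarrow> real) \<Rightarrow> (real \<Rightarrow> real) \<Rightarrow>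
   (real \<Rightarrow> real \<Rightarrow> 'x \<times> 'v::real_normed_vector \<Rightarrow> 'x \<times> 'v) \<Rightarrow> bool" where
  "exponential_growth_with M \<omega> C \<longleftrightarrow>
     mono_on {0..} M \<and> (\<forall>s\<ge>0. 1 \<le> M s) \<and>
     mono_on {0..} \<omega> \<and> (\<forall>s\<ge>0. 1 \<le> \<omega> s) \<and>
     (\<forall>t s t0 x v. (t, s) \<in> evol_times \<longrightarrow> (s, t0) \<in> evol_times \<longrightarrow>
        norm (snd (C t t0 (x, v))) \<le> M s * exp (\<omega> (t - s)) * norm (snd (C s t0 (x, v))))"

definition exponential_growth ::
  "(real \<Rightarrow> real \<Rightarrow> 'x \<times> 'v::real_normed_vector \<Rightarrow> 'x \<times> 'v) \<Rightarrow> bool" where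
  "exponential_growth C \<longleftrightarrow> (\<exists>M \<omega>. exponential_growth_with M \<omega> C)"

definition bounded_exponential_growth ::
  "(real \<Rightarrow> real \<Rightarrow> 'x \<times> 'v::real_normed_vector \<Rightarrow> 'x \<times> 'v) \<Rightarrow> bool" where
  "bounded_exponential_growth C \<longleftrightarrow>
     (\<exists>M \<omega>. exponential_growth_with M \<omega> C \<and> bounded (M ` {0..}))"

definition exponentially_stable ::
  "(real \<Rightarrow> real \<Rightarrow> 'x \<times> 'v::real_normed_vector \<Rightarrow> 'x \<times> 'v) \<Rightarrow> bool" where
  "exponentially_stable C \<longleftrightarrow>
     (\<exists>N. \<exists>\<alpha>>0. (\<forall>s\<ge>0. 1 \<le> N s) \<and>
       (\<forall>t s t0 x v. (t, s) \<in> evol_times \<longrightarrow> (s, t0) \<in> evol_times \<longrightarrow>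
          norm (snd (C t t0 (x, v))) \<le> N s * exp (- \<alpha> * t) * norm (snd (C s t0 (x, v)))))"

(* The integrand is nonnegative, so the integral is taken with values in [0,\<infinity>];
   the bound then includes its finiteness. *)

definition exponentially_integrally_stable ::
  "(real \<Rightarrow> real \<Rightarrow> 'x \<times> 'v::real_normed_vector \<Rightarrow> 'x \<times> 'v) \<Rightarrow> bool" where
  "exponentially_integrally_stable C \<longleftrightarrow>
     (\<exists>D. \<exists>d>0. (\<forall>s\<ge>0. 0 < D s) \<and>
       (\<forall>s t0 x v. (s, t0) \<in> evol_times \<longrightarrow>
          (\<integral>\<^sup>+t\<in>{s..}. ennreal (exp ((t - s) * d) * norm (snd (C t t0 (x, v)))) \<partial>lebesgue)
            \<le> ennreal (D s * norm (snd (C s t0 (x, v))))))"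

end

theory Submission imports Defs "HOL-Real_Asymp.Real_Asymp" begin

text \<open>
  Write \<open>n t\<close> for the norm of the orbit at time \<open>t\<close>, so that all three notions speak about
  the same nonnegative functions \<open>n\<close> on \<open>[t0, \<infinity>)\<close>.

  A decay rate \<open>\<alpha>\<close> leaves room for the weight \<open>exp ((t - s) * (\<alpha> / 2))\<close>: the product still decays
  at rate \<open>\<alpha> / 2\<close>, so its integral converges
  (\<open>exponentially_stable_imp_integrally_stable\<close>).

  Conversely, an integral bound says nothing about single values of \<open>n\<close>, and this is where the
  growth hypothesis enters.  Growth with a bounded factor means that \<open>n t\<close> is at most a
  constant \<open>L\<close> times \<open>n \<tau>\<close> for each \<open>\<tau>\<close> in the unit window before \<open>t\<close>, with the same \<open>L\<close>
  for all \<open>t\<close> (\<open>bounded_growth_unit_window\<close>).  The weighted integral over that window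
  therefore dominates \<open>exp ((t - 1 - s) * d) * n t / L\<close>, and the integral bound becomes pointwise
  decay at rate \<open>d\<close>.  When \<open>t\<close> is within distance 1 of \<open>s\<close> the window would reach back
  beyond \<open>s\<close>; there the growth bound from \<open>s\<close> to \<open>t\<close> is enough.
\<close>

lemma nn_integral_exp_decay_atLeast:
  fixes b s :: real
  assumes "0 < b"
  shows "(\<integral>\<^sup>+t\<in>{s..}. ennreal (exp (- b * (t - s))) \<partial>lebesgue) = ennreal (1 / b)"
proof -
  have "(\<integral>\<^sup>+t. ennreal (exp (- b * (t - s))) * indicator {s..} t \<partial>lborel)
        = ennreal (0 - (- exp (- b * (s - s)) / b))"
  proof (rule nn_integral_FTC_atLeast[where F = "\<lambda>t. - exp (- b * (t - s)) / b"])
    show "((\<lambda>t. - exp (- b * (t - s)) / b) \<longlongrightarrow> 0) at_top"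
      using assms by real_asymp
  qed (use assms in \<open>auto intro!: derivative_eq_intros\<close>)
  then show ?thesis
    by (simp add: nn_integral_completion)
qed

lemma exponentially_stable_imp_integrally_stable:
  fixes C :: "real \<Rightarrow> real \<Rightarrow> 'x \<times> 'v::real_normed_vector \<Rightarrow> 'x \<times> 'v"
  assumes "exponentially_stable C"
  shows "exponentially_integrally_stable C"
proof -
  obtain N \<alpha> where \<alpha>: "0 < \<alpha>" and N: "\<And>s. 0 \<le> s \<Longrightarrow> 1 \<le> N s"
    and decay: "\<And>t s t0 x v. (t, s) \<in> evol_times \<Longrightarrow> (s, t0) \<in> evol_times \<Longrightarrow>
      norm (snd (C t t0 (x, v))) \<le> N s * exp (- \<alpha> * t) * norm (snd (C s t0 (x, v)))"
    using assms unfolding exponentially_stable_def by metis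
  have "(\<integral>\<^sup>+t\<in>{s..}. ennreal (exp ((t - s) * (\<alpha> / 2)) * norm (snd (C t t0 (x, v)))) \<partial>lebesgue)
        \<le> ennreal (2 / \<alpha> * N s * norm (snd (C s t0 (x, v))))" (is "?I \<le> _")
    if st: "(s, t0) \<in> evol_times" for s t0 x v
  proof -
    let ?c = "N s * norm (snd (C s t0 (x, v)))"
    have s: "0 \<le> s" using st by (auto simp: evol_times_def)
    have c: "0 \<le> ?c" using N[OF s] by simp
    have pointwise: "exp ((t - s) * (\<alpha> / 2)) * norm (snd (C t t0 (x, v)))
        \<le> ?c * exp (- (\<alpha> / 2) * (t - s))" if "s \<le> t" for t
    proof -
      have "norm (snd (C t t0 (x, v))) \<le> ?c * exp (- \<alpha> * t)"
        using decay[OF _ st, of t x v] that s by (simp add: evol_times_def ac_simps)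
      also have "\<dots> \<le> ?c * exp (- \<alpha> * (t - s))"
        using c \<alpha> s by (intro mult_left_mono) (auto simp: algebra_simps)
      finally have "exp ((t - s) * (\<alpha> / 2)) * norm (snd (C t t0 (x, v)))
          \<le> exp ((t - s) * (\<alpha> / 2)) * (?c * exp (- \<alpha> * (t - s)))"
        by (intro mult_left_mono) auto
      also have "\<dots> = ?c * (exp ((t - s) * (\<alpha> / 2)) * exp (- \<alpha> * (t - s)))"
        by simp
      also have "\<dots> = ?c * exp (- (\<alpha> / 2) * (t - s))"
        by (simp flip: exp_add)
      finally show ?thesis .
    qed
    have "?I \<le> (\<integral>\<^sup>+t. ennreal ?c * (ennreal (exp (- (\<alpha> / 2) * (t - s))) * indicator {s..} t) \<partial>lebesgue)"
    proof (rule nn_integral_mono)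
      fix t
      show "ennreal (exp ((t - s) * (\<alpha> / 2)) * norm (snd (C t t0 (x, v)))) * indicator {s..} t
        \<le> ennreal ?c * (ennreal (exp (- (\<alpha> / 2) * (t - s))) * indicator {s..} t)"
      proof (cases "s \<le> t")
        case True
        then show ?thesis
          using ennreal_leI[OF pointwise[OF True]] c by (simp add: ennreal_mult)
      qed simp
    qed
    also have "\<dots> = ennreal ?c * (\<integral>\<^sup>+t\<in>{s..}. ennreal (exp (- (\<alpha> / 2) * (t - s))) \<partial>lebesgue)"
      by (rule nn_integral_cmult) (auto intro!: measurable_completion)
    also have "\<dots> = ennreal ?c * ennreal (2 / \<alpha>)"
      using nn_integral_exp_decay_atLeast[of "\<alpha> / 2" s] \<alpha> by simp
    also have "\<dots> = ennreal (2 / \<alpha> * N s * norm (snd (C s t0 (x, v))))"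
      using c \<alpha> by (simp add: ennreal_mult'[symmetric] ac_simps)
    finally show ?thesis .
  qed
  moreover have "0 < 2 / \<alpha> * N s" if "0 \<le> s" for s
    using N[OF that] \<alpha> by simp
  moreover have "0 < \<alpha> / 2" using \<alpha> by simp
  ultimately show ?thesis
    unfolding exponentially_integrally_stable_def
    by (intro exI[of _ "\<lambda>s. 2 / \<alpha> * N s"] exI[of _ "\<alpha> / 2"]) blast
qed

text \<open>
  Since \<open>\<omega>\<close> is monotone, \<open>\<omega> 1\<close> bounds the growth exponent over any time span of
  length at most 1, and the bound on \<open>M\<close> removes the dependence on the starting time.
\<close>

lemma bounded_growth_unit_window:
  fixes C :: "real \<Rightarrow> real \<Rightarrow> 'x \<times> 'v::real_normed_vector \<Rightarrow> 'x \<times> 'v"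
  assumes "bounded_exponential_growth C"
  shows "\<exists>L\<ge>1. \<forall>t s t0 x v. (t, s) \<in> evol_times \<longrightarrow> (s, t0) \<in> evol_times \<longrightarrow> t \<le> s + 1 \<longrightarrow>
    norm (snd (C t t0 (x, v))) \<le> L * norm (snd (C s t0 (x, v)))"
proof -
  obtain M \<omega> where g: "exponential_growth_with M \<omega> C" and "bounded (M ` {0..})"
    using assms unfolding bounded_exponential_growth_def by blast
  then obtain K where "\<And>s. 0 \<le> s \<Longrightarrow> \<bar>M s\<bar> \<le> K"
    by (auto simp: bounded_iff)
  then have K: "\<And>s. 0 \<le> s \<Longrightarrow> M s \<le> K"
    by (meson abs_le_D1)
  have M: "\<And>s. 0 \<le> s \<Longrightarrow> 1 \<le> M s" and \<omega>: "\<And>s. 0 \<le> s \<Longrightarrow> 1 \<le> \<omega> s"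
    and mono: "mono_on {0..} \<omega>"
    and growth: "\<And>t s t0 x v. (t, s) \<in> evol_times \<Longrightarrow> (s, t0) \<in> evol_times \<Longrightarrow>
      norm (snd (C t t0 (x, v))) \<le> M s * exp (\<omega> (t - s)) * norm (snd (C s t0 (x, v)))"
    using g unfolding exponential_growth_with_def by blast+
  have K1: "1 \<le> K" using M[of 0] K[of 0] by simp
  show ?thesis
  proof (intro exI[of _ "K * exp (\<omega> 1)"] conjI allI impI)
    show "1 \<le> K * exp (\<omega> 1)"
      using mult_mono[of 1 K 1 "exp (\<omega> 1)"] K1 \<omega>[of 1] by simp
    fix t s t0 x v
    assume ts: "(t, s) \<in> evol_times" and st: "(s, t0) \<in> evol_times" and "t \<le> s + 1"
    then have "0 \<le> s" "\<omega> (t - s) \<le> \<omega> 1"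
      by (auto simp: evol_times_def intro!: mono_onD[OF mono])
    then have "M s * exp (\<omega> (t - s)) \<le> K * exp (\<omega> 1)"
      using K[of s] K1 by (intro mult_mono) auto
    then have "M s * exp (\<omega> (t - s)) * norm (snd (C s t0 (x, v)))
      \<le> K * exp (\<omega> 1) * norm (snd (C s t0 (x, v)))"
      by (rule mult_right_mono) simp
    with growth[OF ts st, of x v]
    show "norm (snd (C t t0 (x, v))) \<le> K * exp (\<omega> 1) * norm (snd (C s t0 (x, v)))"
      by (rule order_trans)
  qed
qed

text \<open>
  Comparing \<open>n t\<close> with the integral over \<open>[t - 1, t]\<close> costs \<open>exp d\<close>, since the weight at the start
  of the window stands in for the weight at \<open>t\<close>, and the factor \<open>L\<close>.  Both are independent of \<open>t\<close>,
  so the rate \<open>d\<close> survives unchanged.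
\<close>

lemma integrally_stable_imp_exponentially_stable:
  fixes C :: "real \<Rightarrow> real \<Rightarrow> 'x \<times> 'v::real_normed_vector \<Rightarrow> 'x \<times> 'v"
  assumes "bounded_exponential_growth C"
    and "exponentially_integrally_stable C"
  shows "exponentially_stable C"
proof -
  obtain L where L: "1 \<le> L"
    and window: "\<And>t s t0 x v. (t, s) \<in> evol_times \<Longrightarrow> (s, t0) \<in> evol_times \<Longrightarrow> t \<le> s + 1 \<Longrightarrow>
      norm (snd (C t t0 (x, v))) \<le> L * norm (snd (C s t0 (x, v)))"
    using bounded_growth_unit_window[OF assms(1)] by metis
  obtain D d where d: "0 < d" and D: "\<And>s. 0 \<le> s \<Longrightarrow> 0 < D s"
    and int: "\<And>s t0 x v. (s, t0) \<in> evol_times \<Longrightarrow>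
      (\<integral>\<^sup>+t\<in>{s..}. ennreal (exp ((t - s) * d) * norm (snd (C t t0 (x, v)))) \<partial>lebesgue)
        \<le> ennreal (D s * norm (snd (C s t0 (x, v))))"
    using assms(2) unfolding exponentially_integrally_stable_def by blast
  \<comment> \<open>The summand 1 serves the times up to \<open>s + 1\<close>, the summand \<open>D s\<close> the later ones; the factor
      \<open>exp (d * (s + 1))\<close> converts \<open>exp (- d * (t - 1 - s))\<close> into \<open>exp (- d * t)\<close>.\<close>
  define N where "N s = L * exp (d * (s + 1)) * (1 + D s)" for s
  have N: "1 \<le> N s" if "0 \<le> s" for s
  proof -
    have "1 \<le> exp (d * (s + 1))" using d that by simp
    with L have "1 * 1 \<le> L * exp (d * (s + 1))" by (intro mult_mono) auto
    then have "1 * 1 \<le> L * exp (d * (s + 1)) * (1 + D s)"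
      using D[OF that] by (intro mult_mono) auto
    then show ?thesis by (simp add: N_def)
  qed
  have "norm (snd (C t t0 (x, v))) \<le> N s * exp (- d * t) * norm (snd (C s t0 (x, v)))"
    if ts: "(t, s) \<in> evol_times" and st: "(s, t0) \<in> evol_times" for t s t0 x v
  proof -
    let ?n = "\<lambda>t. norm (snd (C t t0 (x, v)))"
    have D0: "0 < D s" and le: "0 \<le> t0" "t0 \<le> s" "s \<le> t"
      using ts st D by (auto simp: evol_times_def)
    have weighted: "exp ((t - 1 - s) * d) * ?n t \<le> L * (1 + D s) * ?n s"
    proof (cases "t \<le> s + 1")
      case True
      have "exp ((t - 1 - s) * d) \<le> 1"
        using True d by (simp add: mult_nonpos_nonneg)
      then have "exp ((t - 1 - s) * d) * ?n t \<le> 1 * ?n t"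
        by (rule mult_right_mono) simp
      also have "\<dots> \<le> L * ?n s" using window[OF ts st True] by simp
      also have "\<dots> \<le> L * (1 + D s) * ?n s"
        using L D0 by (intro mult_right_mono) auto
      finally show ?thesis .
    next
      case False
      let ?k = "exp ((t - 1 - s) * d) * (?n t / L)"
      have k: "0 \<le> ?k" using L by simp
      have "ennreal ?k = (\<integral>\<^sup>+\<tau>\<in>{t - 1..t}. ennreal ?k \<partial>lebesgue)"
        by (simp add: nn_integral_cmult_indicator)
      also have "\<dots> \<le> (\<integral>\<^sup>+\<tau>\<in>{s..}. ennreal (exp ((\<tau> - s) * d) * ?n \<tau>) \<partial>lebesgue)"
      proof (rule nn_integral_mono)
        fix \<tau>
        show "ennreal ?k * indicator {t - 1..t} \<tau>
          \<le> ennreal (exp ((\<tau> - s) * d) * ?n \<tau>) * indicator {s..} \<tau>"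
        proof (cases "\<tau> \<in> {t - 1..t}")
          case True
          then have "?n t \<le> L * ?n \<tau>"
            using le False by (intro window) (auto simp: evol_times_def)
          then have "?n t / L \<le> ?n \<tau>"
            using L by (simp add: field_simps)
          then have "?k \<le> exp ((\<tau> - s) * d) * ?n \<tau>"
            using True d L by (intro mult_mono) auto
          then show ?thesis
            using True False by (auto simp: indicator_def intro!: ennreal_leI)
        qed simp
      qed
      also have "\<dots> \<le> ennreal (D s * ?n s)" by (rule int[OF st])
      finally have "?k \<le> D s * ?n s"
        using D0 by (subst (asm) ennreal_le_iff) auto
      then have "exp ((t - 1 - s) * d) * ?n t \<le> L * (D s * ?n s)"
        using L by (simp add: field_simps)
      also have "\<dots> \<le> L * (1 + D s) * ?n s"
        using L D0 by (simp add: algebra_simps)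
      finally show ?thesis .
    qed
    have "?n t = exp (- ((t - 1 - s) * d)) * (exp ((t - 1 - s) * d) * ?n t)"
      by (simp add: exp_minus)
    also have "\<dots> \<le> exp (- ((t - 1 - s) * d)) * (L * (1 + D s) * ?n s)"
      using weighted by (rule mult_left_mono) simp
    also have "- ((t - 1 - s) * d) = d * (s + 1) + - d * t"
      by (simp add: algebra_simps)
    finally show ?thesis
      by (simp only: N_def exp_add ac_simps)
  qed
  with N d show ?thesis
    unfolding exponentially_stable_def by blast
qed

theorem theorem4p1:
  fixes \<phi> :: "real \<Rightarrow> real \<Rightarrow> 'x::metric_space \<Rightarrow> 'x"
    and \<Phi> :: "real \<Rightarrow> real \<Rightarrow> 'x \<Rightarrow> 'v::banach \<Rightarrow>\<^sub>L 'v"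
    and C :: "real \<Rightarrow> real \<Rightarrow> 'x \<times> 'v \<Rightarrow> 'x \<times> 'v"
  assumes "skew_evolution_semiflow \<phi> \<Phi> C"
    and "strongly_measurable C"
    and "bounded_exponential_growth C"
  shows "exponentially_stable C \<longleftrightarrow> exponentially_integrally_stable C"
  using exponentially_stable_imp_integrally_stable
    integrally_stable_imp_exponentially_stable[OF assms(3)]
  by blast

end
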